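(* Let $N,d\ge 1$ be integers and let $T_1,\ldots,T_N\colon\mathbb{R}^d\to\mathbb{R}^d$ be affine transformations all of which are contracting with respect to some fixed norm on $\mathbb{R}^d$. For each $i=1,\ldots,N$ let $A_i\in M_d(\mathbb{R})$ denote the linearisation of $T_i$. Let $D\ge 1$ be the dimension (as a real vector space) of the smallest subalgebra of $M_d(\mathbb{R})$ which contains $A_1,\ldots,A_N$ and the identity. Then there exists an affine subspace $X\subseteq\mathbb{R}^d$ with dimension not greater than $(N-1)D$ such that $T_iX\subseteq X$ for every $i=1,\ldots,N$. The affine subspace $X$ contains the attractor of $(T_1,\ldots,T_N)$ as a subset; in particular, if $(N-1)D<\dim_{\mathsf{aff}}(T_1,\ldots,T_N)$, then the Hausdorff dimension of the attractor of $(T_1,\ldots,T_N)$ is strictly smaller than the affinity dimension $\dim_{\mathsf{aff}}(T_1,\ldots,T_N)$.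
   Context: $M_d(\mathbb{R})$ is the algebra of real $d\times d$ matrices. An affine transformation $T$ of $\mathbb{R}^d$ has the form $Tx=Ax+v$ with $A\in M_d(\mathbb{R})$ and $v\in\mathbb{R}^d$; $A$ is its linearisation (not assumed invertible). A map $T$ is contracting with respect to a norm $\|\cdot\|$ if there is $c<1$ with $\|Tx-Ty\|\le c\|x-y\|$ for all $x,y\in\mathbb{R}^d$; the same norm is used for all $T_i$ and it need not be Euclidean. An affine subspace is a translate of a vector subspace (in particular nonempty), and its dimension is that of the vector subspace. The attractor of $(T_1,\ldots,T_N)$ is the unique nonempty compact set $Z\subseteq\mathbb{R}^d$ satisfying $Z=\bigcup_{i=1}^N T_iZ$. For $A\in M_d(\mathbb{R})$ let $\sigma_1(A)\ge\cdots\ge\sigma_d(A)$ be the singular values of $A$, i.e. the square roots of the eigenvalues of $A^TA$, listed in decreasing order with multiplicity. For $s\ge 0$ define $\varphi^s\colon M_d(\mathbb{R})\to[0,\infty)$ by $\varphi^s(A)=\sigma_1(A)\cdots\sigma_{\lfloor s\rfloor}(A)\,\sigma_{\lceil s\rceil}(A)^{s-\lfloor s\rfloor}$ if $0\le s\le d$ (when $s$ is an integer the last factor is taken to be $1$, and the empty product is $1$), and $\varphi^s(A)=|\det A|^{s/d}$ if $s>d$. The affinity dimension is $$\dim_{\mathsf{aff}}(T_1,\ldots,T_N)=\dim_{\mathsf{aff}}(A_1,\ldots,A_N):=\inf\left\{s\ge 0\colon \lim_{n\to\infty}\frac1n\log\sum_{i_1,\ldots,i_n=1}^N\varphi^s(A_{i_1}\cdots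 A_{i_n})\le 0\right\},$$ with the convention $\log 0=-\infty$. *)

theory Defs
  imports "HOL-Analysis.Analysis" "HOL-Computational_Algebra.Polynomial"
begin

definition is_norm :: "('a::real_vector \<Rightarrow> real) \<Rightarrow> bool" where
  "is_norm nrm \<longleftrightarrow>
     (\<forall>x. 0 \<le> nrm x) \<and>
     (\<forall>x. nrm x = 0 \<longleftrightarrow> x = 0) \<and>
     (\<forall>c x. nrm (c *\<^sub>R x) = \<bar>c\<bar> * nrm x) \<and>
     (\<forall>x y. nrm (x + y) \<le> nrm x + nrm y)"

definition contracting_wrt :: "('a::real_vector \<Rightarrow> real) \<Rightarrow> ('a \<Rightarrow> 'a) \<Rightarrow> bool" where
  "contracting_wrt nrm T \<longleftrightarrow> (\<exists>c<1. \<forall>x y. nrm (T x - T y) \<le> c * nrm (x - y))"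

(* The library product * on real^'d^'d is entrywise, so the real_algebra class does not apply here. *)
definition matrix_subalgebra :: "(real^'d^'d) set \<Rightarrow> bool" where
  "matrix_subalgebra S \<longleftrightarrow> subspace S \<and> (\<forall>A\<in>S. \<forall>B\<in>S. A ** B \<in> S)"

definition is_attractor :: "nat \<Rightarrow> (nat \<Rightarrow> 'a \<Rightarrow> 'a) \<Rightarrow> 'a::topological_space set \<Rightarrow> bool" where
  "is_attractor N T Z \<longleftrightarrow> Z \<noteq> {} \<and> compact Z \<and> Z = (\<Union>i\<in>{1..N}. T i ` Z)"

definition attractor :: "nat \<Rightarrow> (nat \<Rightarrow> 'a \<Rightarrow> 'a) \<Rightarrow> 'a::topological_space set" where
  "attractor N T = (THE Z. is_attractor N T Z)"

definition charpoly :: "real^'d^'d \<Rightarrow> real poly" where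
  "charpoly M = det (mat [:0, 1:] - map_matrix (\<lambda>c. [:c:]) M)"

definition singular_values :: "real^'d^'d \<Rightarrow> real list" where
  "singular_values A =
     rev (sorted_list_of_multiset (image_mset sqrt (proots (charpoly (transpose A ** A)))))"

(* Indexed from 1. *)
definition singular_value :: "nat \<Rightarrow> real^'d^'d \<Rightarrow> real" where
  "singular_value k A = singular_values A ! (k - 1)"

(* The case split on integral s is needed because 0 powr 0 = 0 in the library. *)
definition singular_value_function :: "real \<Rightarrow> real^'d^'d \<Rightarrow> real" where
  "singular_value_function s A =
     (if s \<le> real CARD('d)
      then (\<Prod>k=1..nat \<lfloor>s\<rfloor>. singular_value k A) *
           (if s \<in> \<int> then 1 else singular_value (nat \<lceil>s\<rceil>) A powr (s - of_int \<lfloor>s\<rfloor>))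
      else \<bar>det A\<bar> powr (s / real CARD('d)))"

(* Used for nonnegative arguments only; unlike ln it takes the value -\<infinity> at 0. *)
definition extended_ln :: "real \<Rightarrow> ereal" where
  "extended_ln x = (if x = 0 then -\<infinity> else ereal (ln x))"

definition word_product :: "(nat \<Rightarrow> real^'d^'d) \<Rightarrow> nat list \<Rightarrow> real^'d^'d" where
  "word_product A w = foldr (\<lambda>i P. A i ** P) w (mat 1)"

definition pressure :: "nat \<Rightarrow> (nat \<Rightarrow> real^'d^'d) \<Rightarrow> real \<Rightarrow> ereal" where
  "pressure N A s =
     lim (\<lambda>n. ereal (1 / real n) *
       extended_ln (\<Sum>w | length w = n \<and> set w \<subseteq> {1..N}.
         singular_value_function s (word_product A w)))"

definition affinity_dim :: "nat \<Rightarrow> (nat \<Rightarrow> real^'d^'d) \<Rightarrow> ereal" where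
  "affinity_dim N A = (INF s \<in> {s. 0 \<le> s \<and> pressure N A s \<le> 0}. ereal s)"

(* diam(U)^s with the conventions that the empty set has weight 0 and that 0^0 = 1. *)
definition hausdorff_weight :: "real \<Rightarrow> 'a::metric_space set \<Rightarrow> ennreal" where
  "hausdorff_weight s U =
     (if U = {} then 0 else if s = 0 then 1 else ennreal (diameter U powr s))"

(* Boundedness is required since diameter is a real-valued supremum,
   unspecified for unbounded sets. *)
definition hausdorff_premeasure :: "real \<Rightarrow> real \<Rightarrow> 'a::metric_space set \<Rightarrow> ennreal" where
  "hausdorff_premeasure s \<delta> E =
     (INF U \<in> {U :: nat \<Rightarrow> 'a set.
        E \<subseteq> (\<Union>j. U j) \<and> (\<forall>j. bounded (U j) \<and> diameter (U j) \<le> \<delta>)}.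
      \<Sum>j. hausdorff_weight s (U j))"

definition hausdorff_measure :: "real \<Rightarrow> 'a::metric_space set \<Rightarrow> ennreal" where
  "hausdorff_measure s E = (SUP \<delta>\<in>{0<..}. hausdorff_premeasure s \<delta> E)"

definition hausdorff_dim :: "'a::metric_space set \<Rightarrow> ereal" where
  "hausdorff_dim E = (INF s \<in> {s. 0 \<le> s \<and> hausdorff_measure s E = 0}. ereal s)"

end

theory Submission
  imports Defs
begin

text \<open>
  A common contraction norm gives \<open>T\<^sub>1\<close> a fixed point \<open>p\<close>. Put \<open>w\<^sub>i = T\<^sub>i p - p\<close>, so that \<open>w\<^sub>1 = 0\<close>, and let
  \<open>V\<close> be the span of the vectors \<open>B w\<^sub>i\<close> with \<open>i \<ge> 2\<close> and \<open>B\<close> in the algebra. It has dimension at most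
  \<open>(N - 1) D\<close>, is invariant under every \<open>A\<^sub>i\<close> and contains every \<open>w\<^sub>i\<close>, so \<open>X = p + V\<close> is invariant under
  every \<open>T\<^sub>i\<close>. A closed nonempty forward invariant set attracts every compact set covered by its own
  images, so it contains the attractor. The last claim follows since a bounded subset of \<open>X\<close> has
  Hausdorff dimension at most \<open>dim X\<close>, whatever the affinity dimension is.
\<close>

section \<open>Norms on Euclidean spaces\<close>

lemma is_norm_minus_commute:
  assumes "is_norm nrm"
  shows "nrm (x - y) = nrm (y - x)"
proof -
  have "nrm ((-1) *\<^sub>R (y - x)) = \<bar>-1\<bar> * nrm (y - x)"
    using assms unfolding is_norm_def by blast
  then show ?thesis by simp
qed

text \<open>Expanding \<open>x\<close> in the standard basis and bounding each coordinate by
  \<open>norm x\<close> gives the constant; the added \<open>1\<close> makes its positivity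
  immediate.\<close>

lemma is_norm_le_norm:
  fixes nrm :: "'a::euclidean_space \<Rightarrow> real"
  assumes "is_norm nrm"
  obtains C where "C > 0" "\<And>x. nrm x \<le> C * norm x"
proof
  let ?C = "(\<Sum>b\<in>Basis. nrm b) + 1"
  have pos: "0 \<le> nrm x" for x
    using assms by (simp add: is_norm_def)
  then show "?C > 0"
    by (simp add: add_nonneg_pos sum_nonneg)
  have sum_le: "nrm (\<Sum>b\<in>F. f b) \<le> (\<Sum>b\<in>F. nrm (f b))" if "finite F" for F and f :: "'a \<Rightarrow> 'a"
    using that
  proof (induction F rule: finite_induct)
    case empty
    have "nrm 0 = 0" using assms unfolding is_norm_def by blast
    then show ?case by simp
  next
    case (insert b F)
    have "nrm (f b + sum f F) \<le> nrm (f b) + nrm (sum f F)"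
      using assms by (simp add: is_norm_def)
    then show ?case using insert by simp
  qed
  fix x :: 'a
  have "nrm x = nrm (\<Sum>b\<in>Basis. (x \<bullet> b) *\<^sub>R b)"
    by (simp add: euclidean_representation)
  also have "\<dots> \<le> (\<Sum>b\<in>Basis. nrm ((x \<bullet> b) *\<^sub>R b))"
    by (rule sum_le) simp
  also have "\<dots> = (\<Sum>b\<in>Basis. \<bar>x \<bullet> b\<bar> * nrm b)"
    using assms by (simp add: is_norm_def)
  also have "\<dots> \<le> (\<Sum>b\<in>Basis. norm x * nrm b)"
    by (intro sum_mono mult_right_mono Basis_le_norm pos)
  also have "\<dots> \<le> ?C * norm x"
    by (simp add: sum_distrib_left[symmetric] algebra_simps)
  finally show "nrm x \<le> ?C * norm x" .
qed

lemma is_norm_continuous: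
  fixes nrm :: "'a::euclidean_space \<Rightarrow> real"
  assumes "is_norm nrm"
  shows "continuous_on S nrm"
proof -
  obtain C where C: "C > 0" "\<And>x. nrm x \<le> C * norm x"
    using is_norm_le_norm[OF assms] by blast
  have tri: "nrm (x + y) \<le> nrm x + nrm y" for x y
    using assms by (simp add: is_norm_def)
  have "dist (nrm x) (nrm y) \<le> C * dist x y" for x y
    using tri[of "x - y" y] tri[of "y - x" x] C(2)[of "x - y"]
      is_norm_minus_commute[OF assms, of x y]
    by (simp add: dist_norm abs_le_iff)
  then have "C-lipschitz_on S nrm"
    using C(1) by (simp add: lipschitz_on_def)
  then show ?thesis
    by (rule lipschitz_on_continuous_on)
qed

text \<open>By continuity \<open>nrm\<close> attains its minimum on the compact Euclidean unit
  sphere. That minimum is positive, and homogeneity carries the bound to all vectors.\<close>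

lemma is_norm_ge_norm:
  fixes nrm :: "'a::euclidean_space \<Rightarrow> real"
  assumes "is_norm nrm"
  obtains K where "K > 0" "\<And>x. norm x \<le> K * nrm x"
proof -
  have "sphere (0::'a) 1 \<noteq> {}"
    by simp
  then obtain u where u: "u \<in> sphere (0::'a) 1" "\<And>y. y \<in> sphere 0 1 \<Longrightarrow> nrm u \<le> nrm y"
    using continuous_attains_inf[OF compact_sphere _ is_norm_continuous[OF assms]] by blast
  have "u \<noteq> 0"
    using u(1) by auto
  then have pos: "nrm u > 0"
    using assms unfolding is_norm_def by (metis less_eq_real_def)
  have "norm x \<le> inverse (nrm u) * nrm x" for x
  proof (cases "x = 0")
    case True
    then show ?thesis using assms by (simp add: is_norm_def)
  next
    case False
    have "nrm u \<le> nrm ((1 / norm x) *\<^sub>R x)"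
      using False by (intro u(2)) simp
    also have "\<dots> = nrm x / norm x"
      using assms by (simp add: is_norm_def)
    finally show ?thesis
      using False pos by (simp add: field_simps)
  qed
  then show ?thesis
    using pos that[of "inverse (nrm u)"] by simp
qed

lemma contracting_family_uniform:
  assumes "is_norm nrm" "finite I" "\<And>i. i \<in> I \<Longrightarrow> contracting_wrt nrm (T i)"
  obtains c where "0 \<le> c" "c < 1"
    "\<And>i x y. i \<in> I \<Longrightarrow> nrm (T i x - T i y) \<le> c * nrm (x - y)"
proof -
  obtain k where k: "\<And>i. i \<in> I \<Longrightarrow> k i < (1::real)"
    "\<And>i x y. i \<in> I \<Longrightarrow> nrm (T i x - T i y) \<le> k i * nrm (x - y)"
    using assms(3) unfolding contracting_wrt_def by metis
  \<comment> \<open>\<open>contracting_wrt\<close> allows a negative constant, hence the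
    \<open>0\<close>; it also keeps the maximum meaningful for empty \<open>I\<close>.\<close>
  let ?c = "Max (insert 0 (k ` I))"
  have "nrm (T i x - T i y) \<le> ?c * nrm (x - y)" if "i \<in> I" for i x y
  proof -
    have "k i \<le> ?c" "0 \<le> nrm (x - y)"
      using that assms by (auto simp: is_norm_def)
    then show ?thesis
      using k(2)[OF that, of x y] mult_right_mono by (meson order.trans)
  qed
  moreover have "0 \<le> ?c" "?c < 1"
    using assms(2) k(1) by auto
  ultimately show ?thesis
    using that by blast
qed

section \<open>Attractors of contracting families\<close>

lemma is_attractorD:
  assumes "is_attractor N T Z"
  shows "Z \<noteq> {}" "compact Z" "Z \<subseteq> (\<Union>i\<in>{1..N}. T i ` Z)"
    and "\<And>i. i \<in> {1..N} \<Longrightarrow> T i ` Z \<subseteq> Z"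
proof -
  note att = assms[unfolded is_attractor_def]
  note eq = att[THEN conjunct2, THEN conjunct2]
  show "Z \<noteq> {}" "compact Z"
    by (fact att[THEN conjunct1], fact att[THEN conjunct2, THEN conjunct1])
  show "Z \<subseteq> (\<Union>i\<in>{1..N}. T i ` Z)"
    using eq by (rule equalityD1)
  show "T i ` Z \<subseteq> Z" if "i \<in> {1..N}" for i
    using UN_upper[OF that, of "\<lambda>i. T i ` Z"] equalityD2[OF eq] by (rule order_trans)
qed

text \<open>Trace a point of \<open>Z\<close> back through \<open>n\<close> maps inside
  \<open>Z\<close>, then apply the same maps to a chosen point of \<open>W\<close>: the result lies
  in \<open>W\<close>, at distance at most a constant times \<open>c ^ n\<close>. Closedness of
  \<open>W\<close> concludes. This yields both the uniqueness of the attractor and its inclusion in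
  the invariant affine subspace.\<close>

lemma subset_of_forward_invariant:
  fixes nrm :: "'a::euclidean_space \<Rightarrow> real"
  assumes nrm: "is_norm nrm"
    and c: "0 \<le> c" "c < 1" "\<And>i x y. i \<in> I \<Longrightarrow> nrm (T i x - T i y) \<le> c * nrm (x - y)"
    and Z: "compact Z" "Z \<subseteq> (\<Union>i\<in>I. T i ` Z)"
    and W: "closed W" "W \<noteq> {}" "\<And>i. i \<in> I \<Longrightarrow> T i ` W \<subseteq> W"
  shows "Z \<subseteq> W"
proof
  fix z assume z: "z \<in> Z"
  obtain w0 where w0: "w0 \<in> W" using W(2) by blast
  obtain C where C: "C > 0" "\<And>x. nrm x \<le> C * norm x"
    using is_norm_le_norm[OF nrm] by blast
  obtain K where K: "K > 0" "\<And>x. norm x \<le> K * nrm x"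
    using is_norm_ge_norm[OF nrm] by blast
  have "bounded ((\<lambda>x. x - w0) ` Z)"
    using bounded_translation[OF compact_imp_bounded[OF Z(1)], of "- w0"] by simp
  then obtain M where M: "\<And>x. x \<in> Z \<Longrightarrow> norm (x - w0) \<le> M"
    by (auto simp: bounded_iff)
  have approx: "\<exists>w\<in>W. nrm (x - w) \<le> c ^ n * (C * M)" if "x \<in> Z" for n x
    using that
  proof (induction n arbitrary: x)
    case 0
    have "nrm (x - w0) \<le> C * M"
      using order_trans[OF C(2) mult_left_mono[OF M[OF 0] less_imp_le[OF C(1)]]] .
    then show ?case using w0 by auto
  next
    case (Suc n)
    obtain i y where i: "i \<in> I" "y \<in> Z" "x = T i y"
      using subsetD[OF Z(2) Suc.prems] by blast
    obtain w where w: "w \<in> W" "nrm (y - w) \<le> c ^ n * (C * M)"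
      using Suc.IH[OF i(2)] by blast
    have "nrm (x - T i w) \<le> c * nrm (y - w)"
      using c(3)[OF i(1)] i(3) by simp
    also have "\<dots> \<le> c ^ Suc n * (C * M)"
      using mult_left_mono[OF w(2) c(1)] by (simp add: mult.assoc)
    finally show ?case
      using subsetD[OF W(3)[OF i(1)] imageI[OF w(1)]] by (rule bexI)
  qed
  have "\<forall>n. \<exists>w. w \<in> W \<and> nrm (z - w) \<le> c ^ n * (C * M)"
    using approx[OF z] by blast
  then obtain w where w: "\<And>n. w n \<in> W" "\<And>n. nrm (z - w n) \<le> c ^ n * (C * M)"
    by metis
  have "(\<lambda>n. K * (c ^ n * (C * M))) \<longlonglongrightarrow> K * (0 * (C * M))"
    using c by (intro tendsto_intros LIMSEQ_power_zero) auto
  then have lim0: "(\<lambda>n. K * (c ^ n * (C * M))) \<longlonglongrightarrow> 0" by simp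
  \<comment> \<open>The constant \<open>K\<close> turns the geometric decay in \<open>nrm\<close>
    into Euclidean convergence.\<close>
  have "dist (w n) z \<le> K * (c ^ n * (C * M))" for n
    using K(2)[of "z - w n"] mult_left_mono[OF w(2)[of n] less_imp_le[OF K(1)]]
    by (simp add: dist_norm norm_minus_commute)
  then have "(\<lambda>n. dist (w n) z) \<longlonglongrightarrow> 0"
    by (intro tendsto_sandwich[OF _ _ tendsto_const lim0]) auto
  then have "w \<longlonglongrightarrow> z"
    by (rule tendsto_dist_iff[THEN iffD2])
  then show "z \<in> W"
    using closed_sequentially[OF W(1)] w(1) by blast
qed

text \<open>The iterates of the union operator \<open>F\<close> on \<open>B\<close> form a
  decreasing chain of nonempty compact sets; their intersection is the fixed set.\<close>

lemma ex_fixed_compact: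
  fixes T :: "'i \<Rightarrow> 'a::heine_borel \<Rightarrow> 'a"
  assumes I: "finite I" "I \<noteq> {}"
    and cont: "\<And>i. i \<in> I \<Longrightarrow> continuous_on UNIV (T i)"
    and B: "compact B" "B \<noteq> {}" "\<And>i. i \<in> I \<Longrightarrow> T i ` B \<subseteq> B"
  obtains Z where "compact Z" "Z \<noteq> {}" "Z = (\<Union>i\<in>I. T i ` Z)"
proof -
  define F where "F = (\<lambda>S. \<Union>i\<in>I. T i ` S)"
  define K where "K = (\<lambda>n. (F ^^ n) B)"
  have mono: "F S \<subseteq> F S'" if "S \<subseteq> S'" for S S'
    using that by (auto simp: F_def)
  have K_Suc: "K (Suc n) = F (K n)" for n
    by (simp add: K_def)
  have comp: "compact (K n)" for n
  proof (induction n)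
    case (Suc n)
    then show ?case
      unfolding K_Suc F_def using I cont
      by (intro compact_UN compact_continuous_image) (auto intro: continuous_on_subset)
  qed (simp add: K_def B)
  have ne: "K n \<noteq> {}" for n
    by (induction n) (use I B in \<open>auto simp: K_def F_def\<close>)
  have step: "K (Suc n) \<subseteq> K n" for n
  proof (induction n)
    case 0
    then show ?case using B(3) by (auto simp: K_def F_def)
  next
    case (Suc n)
    then show ?case using mono by (metis K_Suc)
  qed
  have dec: "K n \<subseteq> K m" if "m \<le> n" for m n
    using lift_Suc_antimono_le[of K, OF step that] .
  define Z where "Z = (\<Inter>n. K n)"
  have "compact Z"
    unfolding Z_def using comp by (intro compact_Inter) blast+
  moreover have "Z \<noteq> {}"
    unfolding Z_def by (intro compact_nest comp ne dec)
  moreover have "F Z \<subseteq> Z"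
  proof -
    have "F Z \<subseteq> K n" for n
      using mono[of Z "K n"] step[of n] K_Suc[of n] by (auto simp: Z_def)
    then show ?thesis by (auto simp: Z_def)
  qed
  moreover have "Z \<subseteq> F Z"
  proof
    fix z assume z: "z \<in> Z"
    \<comment> \<open>The points of \<open>K n\<close> sent to \<open>z\<close> by some
      \<open>T i\<close>. These sets are compact, nested and nonempty, as \<open>z\<close> lies in
      \<open>K (Suc n)\<close>. A point common to all of them lies in \<open>Z\<close> and is a
      preimage of \<open>z\<close>.\<close>
    define L where "L = (\<lambda>n. K n \<inter> (\<Union>i\<in>I. T i -` {z}))"
    have "closed (T i -` {z})" if "i \<in> I" for i
      using continuous_closed_vimage[of "{z}" "T i"] cont[OF that]
      by (simp add: continuous_on_eq_continuous_at)
    then have "compact (L n)" for n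
      unfolding L_def using comp I by (intro compact_Int_closed closed_UN) auto
    moreover have "L n \<noteq> {}" for n
    proof -
      have "z \<in> F (K n)"
        using z K_Suc[of n] by (auto simp: Z_def)
      then show ?thesis by (auto simp: L_def F_def)
    qed
    moreover have "L n \<subseteq> L m" if "m \<le> n" for m n
      using dec[OF that] by (auto simp: L_def)
    ultimately have "(\<Inter>n. L n) \<noteq> {}"
      by (intro compact_nest) auto
    then obtain y where y: "\<And>n. y \<in> L n" by blast
    then have "y \<in> Z" by (simp add: L_def Z_def)
    moreover obtain i where "i \<in> I" "T i y = z"
      using y[of 0] by (auto simp: L_def)
    ultimately show "z \<in> F Z"
      by (auto simp: F_def)
  qed
  ultimately show ?thesis
    using that[of Z] equalityI[of Z "F Z"] unfolding F_def by satx
qed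

text \<open>Justifies the definite description in \<open>attractor\<close>: existence comes from a
  compact ball of \<open>nrm\<close> that all maps preserve, uniqueness from comparing two
  attractors in both directions.\<close>

lemma is_attractor_attractor:
  fixes nrm :: "'a::euclidean_space \<Rightarrow> real"
  assumes N: "N \<ge> 1" and nrm: "is_norm nrm"
    and T: "\<And>i. i \<in> {1..N} \<Longrightarrow> contracting_wrt nrm (T i)"
  shows "is_attractor N T (attractor N T)"
proof -
  obtain c where c: "0 \<le> c" "c < 1"
    "\<And>i x y. i \<in> {1..N} \<Longrightarrow> nrm (T i x - T i y) \<le> c * nrm (x - y)"
    using contracting_family_uniform[of nrm "{1..N}" T] nrm T by auto
  obtain C where C: "C > 0" "\<And>x. nrm x \<le> C * norm x"
    using is_norm_le_norm[OF nrm] by blast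
  obtain K where K: "K > 0" "\<And>x. norm x \<le> K * nrm x"
    using is_norm_ge_norm[OF nrm] by blast
  have cont: "continuous_on UNIV (T i)" if "i \<in> {1..N}" for i
  proof -
    have "dist (T i x) (T i y) \<le> (K * c * C) * dist x y" for x y
    proof -
      have "norm (T i x - T i y) \<le> K * nrm (T i x - T i y)" by (rule K)
      also have "\<dots> \<le> K * (c * (C * norm (x - y)))"
        using K(1) order_trans[OF c(3)[OF that] mult_left_mono[OF C(2) c(1)], of x y]
        by simp
      finally show ?thesis by (simp add: dist_norm mult_ac)
    qed
    then have "(K * c * C)-lipschitz_on UNIV (T i)"
      using K c C by (simp add: lipschitz_on_def)
    then show ?thesis by (rule lipschitz_on_continuous_on)
  qed
  define M where "M = Max ((\<lambda>i. nrm (T i 0)) ` {1..N})"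
  have M: "nrm (T i 0) \<le> M" if "i \<in> {1..N}" for i
    unfolding M_def using that by (intro Max_ge) auto
  \<comment> \<open>Chosen to solve \<open>c * R + M = R\<close>, so that the ball of
    \<open>nrm\<close> with radius \<open>R\<close> about the origin is mapped into itself.\<close>
  define R where "R = M / (1 - c)"
  have "0 \<le> nrm (T 1 0)" using nrm by (simp add: is_norm_def)
  then have "0 \<le> M" using M[of 1] N by simp
  then have R: "0 \<le> R" "c * R + M = R"
    using c by (auto simp: R_def field_simps)
  define B where "B = {x. nrm x \<le> R}"
  have "closed B"
    unfolding B_def using is_norm_continuous[OF nrm]
    by (intro closed_Collect_le) (auto intro: continuous_intros)
  moreover have "bounded B"
    unfolding bounded_iff B_def
    using K by (intro exI[of _ "K * R"]) (auto intro: order_trans[OF K(2)])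
  ultimately have compB: "compact B" by (simp add: compact_eq_bounded_closed)
  have neB: "B \<noteq> {}"
  proof -
    have "nrm 0 = 0" using nrm unfolding is_norm_def by blast
    then show ?thesis using R by (auto simp: B_def intro!: exI[of _ 0])
  qed
  have invB: "T i ` B \<subseteq> B" if i: "i \<in> {1..N}" for i
  proof
    fix y assume "y \<in> T i ` B"
    then obtain x where x: "nrm x \<le> R" "y = T i x" by (auto simp: B_def)
    have "nrm (T i x - T i 0 + T i 0) \<le> nrm (T i x - T i 0) + nrm (T i 0)"
      using nrm unfolding is_norm_def by blast
    also have "\<dots> \<le> c * R + M"
      using c(3)[OF i, of x 0] M[OF i] mult_left_mono[OF x(1) c(1)] by simp
    finally show "y \<in> B" using R x by (simp add: B_def)
  qed
  have "{1..N} \<noteq> {}" using N by simp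
  then obtain Z where "compact Z" "Z \<noteq> {}" "Z = (\<Union>i\<in>{1..N}. T i ` Z)"
    by (rule ex_fixed_compact[OF finite_atLeastAtMost _ cont compB neB invB])
  then have Z: "is_attractor N T Z" unfolding is_attractor_def by (intro conjI)
  have sub: "Z1 \<subseteq> Z2" if "is_attractor N T Z1" "is_attractor N T Z2" for Z1 Z2
    by (rule subset_of_forward_invariant[where I = "{1..N}" and T = T, OF nrm c])
      (use is_attractorD[OF that(1)] is_attractorD[OF that(2)] in \<open>simp_all add: compact_imp_closed\<close>)
  show ?thesis
    unfolding attractor_def by (rule theI[where P = "is_attractor N T", OF Z]) (intro equalityI sub Z)
qed

section \<open>Hausdorff dimension of bounded subsets of affine subspaces\<close>

text \<open>The finite cover is padded to a sequence by empty sets, which have weight 0; since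
  \<open>s > 0\<close>, every other weight is at most \<open>r powr s\<close>.\<close>

lemma hausdorff_premeasure_le_card:
  fixes E :: "'a::metric_space set"
  assumes "finite I" "E \<subseteq> (\<Union>i\<in>I. C i)" "s > 0" "r \<le> \<delta>" "0 \<le> r"
    and C: "\<And>i. i \<in> I \<Longrightarrow> bounded (C i)" "\<And>i. i \<in> I \<Longrightarrow> diameter (C i) \<le> r"
  shows "hausdorff_premeasure s \<delta> E \<le> ennreal (real (card I) * r powr s)"
proof -
  obtain h where h: "bij_betw h {0..<card I} I"
    using ex_bij_betw_nat_finite[OF assms(1)] by blast
  define U where "U = (\<lambda>j. if j < card I then C (h j) else {})"
  have hI: "h j \<in> I" if "j < card I" for j
    using h that by (auto simp: bij_betw_def)
  have "E \<subseteq> (\<Union>j. U j)"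
  proof
    fix x assume "x \<in> E"
    then obtain i where i: "i \<in> I" "x \<in> C i" using assms(2) by blast
    then obtain j where "j < card I" "h j = i" using h by (force simp: bij_betw_def)
    then show "x \<in> (\<Union>j. U j)" using i by (auto simp: U_def)
  qed
  moreover have "bounded (U j)" "diameter (U j) \<le> \<delta>" for j
    using C hI[of j] assms(4,5) by (force simp: U_def)+
  ultimately have "hausdorff_premeasure s \<delta> E \<le> (\<Sum>j. hausdorff_weight s (U j))"
    unfolding hausdorff_premeasure_def by (intro INF_lower) auto
  also have "\<dots> = (\<Sum>j<card I. hausdorff_weight s (U j))"
    by (intro suminf_finite) (auto simp: U_def hausdorff_weight_def)
  also have "\<dots> \<le> (\<Sum>j<card I. ennreal (r powr s))"
  proof (intro sum_mono)
    fix j assume "j \<in> {..<card I}"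
    then have "bounded (U j)" "diameter (U j) \<le> r"
      using C hI[of j] by (auto simp: U_def)
    then show "hausdorff_weight s (U j) \<le> ennreal (r powr s)"
      using assms(3) by (auto simp: hausdorff_weight_def intro!: ennreal_leI powr_mono2 diameter_ge_0)
  qed
  also have "\<dots> = ennreal (real (card I) * r powr s)"
    by (simp add: ennreal_mult ennreal_of_nat_eq_real_of_nat)
  finally show ?thesis .
qed

text \<open>Coordinates along an orthonormal basis of \<open>V\<close> are rounded down to multiples
  of \<open>1 / n\<close>; each cell collects the points of \<open>E\<close> with the same rounded
  coordinates.\<close>

lemma grid_cover:
  fixes V :: "'a::euclidean_space set" and n R :: nat
  assumes V: "subspace V" and E: "E \<subseteq> (+) p ` V" and R: "\<And>x. x \<in> E \<Longrightarrow> norm x \<le> real R"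
    and n: "n \<ge> 1"
  obtains I :: "('a \<Rightarrow> int) set" and C where "finite I" "card I = (2 * n * R + 1) ^ dim V"
    "E \<subseteq> (\<Union>f\<in>I. C f)"
    "\<And>f. f \<in> I \<Longrightarrow> bounded (C f)" "\<And>f. f \<in> I \<Longrightarrow> diameter (C f) \<le> real (dim V) / real n"
proof -
  obtain B where B: "B \<subseteq> V" "pairwise orthogonal B" "\<And>x. x \<in> B \<Longrightarrow> norm x = 1"
    "independent B" "card B = dim V" "span B = V"
    using orthonormal_basis_subspace[OF V] by metis
  have finB: "finite B"
    using B(4) by (rule independent_imp_finite)
  have expand: "(\<Sum>b\<in>B. (x \<bullet> b) *\<^sub>R b) = x" if "x \<in> V" for x
    using orthonormal_basis_expand[OF B(2,3)] that B(6) finB by blast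
  \<comment> \<open>A coordinate along a unit vector is at most \<open>R\<close> in absolute value,
    so its floor after scaling by \<open>n\<close> takes one of \<open>2 * n * R + 1\<close>
    values.\<close>
  define I where "I = (B \<rightarrow>\<^sub>E {- int (n * R)..int (n * R)})"
  define C where "C = (\<lambda>f. {x\<in>E. \<forall>b\<in>B. \<lfloor>real n * (x \<bullet> b)\<rfloor> = f b})"
  have "finite I"
    unfolding I_def using finB by (intro finite_PiE) auto
  moreover have "card I = (2 * n * R + 1) ^ dim V"
  proof -
    have "nat (2 * (int R * int n) + 1) = 2 * n * R + 1"
      by (simp add: nat_eq_iff mult_ac)
    then show ?thesis
      using finB B(5) by (simp add: I_def card_PiE mult_ac)
  qed
  moreover have "E \<subseteq> (\<Union>f\<in>I. C f)"
  proof
    fix x assume x: "x \<in> E"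
    have "\<lfloor>real n * (x \<bullet> b)\<rfloor> \<in> {- int (n * R)..int (n * R)}" if "b \<in> B" for b
    proof -
      have "\<bar>x \<bullet> b\<bar> \<le> real R"
        using Cauchy_Schwarz_ineq2[of x b] B(3)[OF that] R[OF x] by simp
      then have "\<bar>real n * (x \<bullet> b)\<bar> \<le> real n * real R"
        by (simp add: abs_mult mult_left_mono)
      then have "- real (n * R) \<le> real n * (x \<bullet> b)" "real n * (x \<bullet> b) \<le> real (n * R)"
        by (auto simp: abs_le_iff)
      then show ?thesis
        by (auto simp: le_floor_iff floor_le_iff)
    qed
    then have "restrict (\<lambda>b. \<lfloor>real n * (x \<bullet> b)\<rfloor>) B \<in> I"
      by (auto simp: I_def)
    moreover have "x \<in> C (restrict (\<lambda>b. \<lfloor>real n * (x \<bullet> b)\<rfloor>) B)"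
      using x by (simp add: C_def)
    ultimately show "x \<in> (\<Union>f\<in>I. C f)" by blast
  qed
  moreover have "bounded (C f)" for f
    unfolding bounded_iff using R by (auto simp: C_def)
  moreover have "diameter (C f) \<le> real (dim V) / real n" for f
  proof (rule diameter_le)
    fix x y assume xy: "x \<in> C f" "y \<in> C f"
    \<comment> \<open>The cells use the coordinates of \<open>x\<close> itself, not of
      \<open>x - p\<close>. This is harmless: differences of points of \<open>E\<close> lie in
      \<open>V\<close>, where the coordinates along \<open>B\<close> determine the vector.\<close>
    have "x - y \<in> V"
    proof -
      have "x \<in> (+) p ` V" "y \<in> (+) p ` V"
        using xy E by (auto simp: C_def)
      then obtain u u' where "u \<in> V" "u' \<in> V" "x = p + u" "y = p + u'"
        by blast
      then show ?thesis using subspace_diff[OF V] by simp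
    qed
    then have "norm (x - y) = norm (\<Sum>b\<in>B. ((x - y) \<bullet> b) *\<^sub>R b)"
      using expand by metis
    also have "\<dots> \<le> (\<Sum>b\<in>B. norm (((x - y) \<bullet> b) *\<^sub>R b))"
      by (rule norm_sum)
    also have "\<dots> \<le> (\<Sum>b\<in>B. 1 / real n)"
    proof (rule sum_mono)
      fix b assume b: "b \<in> B"
      have "\<lfloor>real n * (x \<bullet> b)\<rfloor> = \<lfloor>real n * (y \<bullet> b)\<rfloor>"
        using xy b by (simp add: C_def)
      then have "\<bar>real n * (x \<bullet> b) - real n * (y \<bullet> b)\<bar> \<le> 1"
        by linarith
      then have "real n * \<bar>(x - y) \<bullet> b\<bar> \<le> 1"
        by (simp add: inner_diff_left right_diff_distrib[symmetric] abs_mult)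
      then show "norm (((x - y) \<bullet> b) *\<^sub>R b) \<le> 1 / real n"
        using n B(3)[OF b] by (simp add: field_simps)
    qed
    finally show "norm (x - y) \<le> real (dim V) / real n"
      using B(5) by simp
  qed simp
  ultimately show ?thesis
    using that by blast
qed

text \<open>With \<open>m = dim V\<close>, about \<open>n ^ m\<close> cells of diameter at most
  \<open>m / n\<close> cover \<open>E\<close>, so the premeasure is bounded by a constant times
  \<open>n powr (m - s)\<close>, which tends to 0.\<close>

lemma hausdorff_measure_subset_affine:
  fixes V :: "'a::euclidean_space set"
  assumes V: "subspace V" and E: "E \<subseteq> (+) p ` V" "bounded E" and s: "s > real (dim V)"
  shows "hausdorff_measure s E = 0"
proof -
  define m where "m = dim V"
  obtain R0 where R0: "\<And>x. x \<in> E \<Longrightarrow> norm x \<le> R0"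
    using E(2) by (auto simp: bounded_iff)
  \<comment> \<open>The \<open>+ 1\<close> ensures \<open>R \<ge> 1\<close>, which later allows
    \<open>2 * n * R + 1 \<le> 3 * n * R\<close>.\<close>
  define R where "R = nat \<lceil>R0\<rceil> + 1"
  have R: "norm x \<le> real R" if "x \<in> E" for x
    using R0[OF that] unfolding R_def by linarith
  have "hausdorff_premeasure s \<delta> E = 0" if "\<delta> > 0" for \<delta>
  proof -
    define g where "g = (\<lambda>n. (3 * real R) ^ m * real m powr s * (real n powr (real m - s)))"
    have bound: "hausdorff_premeasure s \<delta> E \<le> ennreal (g n)" if n: "n \<ge> 1" "real m / real n \<le> \<delta>" for n
    proof -
      obtain I :: "('a \<Rightarrow> int) set" and C where I: "finite I" "card I = (2 * n * R + 1) ^ m"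
        "E \<subseteq> (\<Union>f\<in>I. C f)" "\<And>f. f \<in> I \<Longrightarrow> bounded (C f)"
        "\<And>f. f \<in> I \<Longrightarrow> diameter (C f) \<le> real m / real n"
        using grid_cover[OF V E(1) R n(1)] unfolding m_def by blast
      have "hausdorff_premeasure s \<delta> E \<le> ennreal (real (card I) * (real m / real n) powr s)"
        using s n by (intro hausdorff_premeasure_le_card[OF I(1,3)] I) auto
      also have "\<dots> \<le> ennreal (g n)"
      proof (rule ennreal_leI)
        have "n * R \<ge> 1"
          using n by (simp add: R_def)
        then have "2 * n * R + 1 \<le> 3 * n * R"
          by simp
        then have "card I \<le> (3 * n * R) ^ m"
          unfolding I(2) by (rule power_mono) simp
        then have "real (card I) \<le> real ((3 * n * R) ^ m)"
          by (simp only: of_nat_le_iff)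
        also have "\<dots> = (3 * real R) ^ m * real n powr real m"
          using n by (simp add: powr_realpow power_mult_distrib)
        finally have "real (card I) * (real m / real n) powr s
            \<le> (3 * real R) ^ m * real n powr real m * (real m / real n) powr s"
          by (rule mult_right_mono) simp
        also have "\<dots> = g n"
          by (simp add: g_def powr_divide powr_diff)
        finally show "real (card I) * (real m / real n) powr s \<le> g n" .
      qed
      finally show ?thesis .
    qed
    have "(\<lambda>n. real n powr (real m - s)) \<longlonglongrightarrow> 0"
      using s by (intro tendsto_neg_powr filterlim_real_sequentially) (simp add: m_def)
    then have "g \<longlonglongrightarrow> (3 * real R) ^ m * real m powr s * 0"
      unfolding g_def by (intro tendsto_intros)
    then have "(\<lambda>n. ennreal (g n)) \<longlonglongrightarrow> ennreal 0"
      by (intro tendsto_ennrealI) simp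
    moreover have "\<forall>\<^sub>F n in sequentially. hausdorff_premeasure s \<delta> E \<le> ennreal (g n)"
    proof -
      have "(\<lambda>n. real m / real n) \<longlonglongrightarrow> 0"
        by (rule lim_const_over_n)
      then have "\<forall>\<^sub>F n in sequentially. real m / real n < \<delta>"
        using that by (rule order_tendstoD)
      then show ?thesis
        using eventually_ge_at_top[of 1] by eventually_elim (use bound in auto)
    qed
    ultimately have "hausdorff_premeasure s \<delta> E \<le> ennreal 0"
      by (intro tendsto_lowerbound) auto
    then show ?thesis by simp
  qed
  then show ?thesis
    by (simp add: hausdorff_measure_def)
qed

text \<open>The measure vanishes for every exponent above \<open>dim V\<close>, so the infimum lies
  below each of them; density of the extended reals gives the bound.\<close>

lemma hausdorff_dim_subset_affine:
  fixes V :: "'a::euclidean_space set"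
  assumes "subspace V" "E \<subseteq> (+) p ` V" "bounded E"
  shows "hausdorff_dim E \<le> ereal (real (dim V))"
proof (rule dense_ge)
  fix t assume t: "ereal (real (dim V)) < t"
  show "hausdorff_dim E \<le> t"
  proof (cases t)
    case (real s)
    then have "s > real (dim V)" using t by simp
    then have "hausdorff_measure s E = 0" "0 \<le> s"
      using hausdorff_measure_subset_affine[OF assms] by auto
    then show ?thesis
      unfolding hausdorff_dim_def real by (intro INF_lower) auto
  qed (use t in auto)
qed

section \<open>The invariant affine subspace\<close>

text \<open>Subalgebras are stable under intersection, so the hull is itself the smallest subalgebra
  containing \<open>S\<close>.\<close>

lemma matrix_subalgebra_hull: "matrix_subalgebra (matrix_subalgebra hull S)"
proof (rule hull_in)
  fix F :: "(real^'n^'n) set set"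
  assume "\<forall>S\<in>F. matrix_subalgebra S"
  then show "matrix_subalgebra (\<Inter>F)"
    by (auto simp: matrix_subalgebra_def intro: subspace_Inter)
qed

text \<open>For each \<open>i\<close> the map \<open>B \<mapsto> B *v w i\<close> is linear, so
  letting \<open>B\<close> run through a basis of the span of \<open>S\<close> already generates
  everything.\<close>

lemma dim_span_orbits_le:
  fixes S :: "(real^'n^'m) set" and w :: "'i \<Rightarrow> real^'n"
  assumes "finite I"
  shows "dim (span (\<Union>i\<in>I. (\<lambda>B. B *v w i) ` S)) \<le> card I * dim S"
proof -
  obtain b where b: "b \<subseteq> S" "independent b" "S \<subseteq> span b" "card b = dim S"
    using basis_exists[of S] by blast
  have finb: "finite b"
    using b(2) by (rule independent_imp_finite)
  let ?G = "\<Union>i\<in>I. (\<lambda>B. B *v w i) ` b"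
  have "B *v w i \<in> span ?G" if "i \<in> I" "B \<in> S" for i B
  proof -
    have lin: "linear (\<lambda>B::real^'n^'m. B *v w i)"
      by (rule linearI) (simp_all add: matrix_vector_mult_add_rdistrib scaleR_matrix_vector_assoc)
    have "B *v w i \<in> (\<lambda>B. B *v w i) ` span b"
      using that b(3) by blast
    also have "\<dots> = span ((\<lambda>B. B *v w i) ` b)"
      using linear_span_image[OF lin] by simp
    also have "\<dots> \<subseteq> span ?G"
      using that by (intro span_mono) blast
    finally show ?thesis .
  qed
  then have "dim (\<Union>i\<in>I. (\<lambda>B. B *v w i) ` S) \<le> card ?G"
    using finb assms by (intro dim_le_card) auto
  also have "\<dots> \<le> (\<Sum>i\<in>I. card ((\<lambda>B. B *v w i) ` b))"
    using assms by (rule card_UN_le)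
  also have "\<dots> \<le> (\<Sum>i\<in>I. dim S)"
    using finb b(4) by (intro sum_mono) (metis card_image_le)
  finally show ?thesis by simp
qed

text \<open>A fixed point solves \<open>p - A *v p = v\<close>. Contraction makes the linear map on
  the left injective, hence surjective in finite dimension.\<close>

lemma contracting_affine_fixed_point:
  fixes A :: "real^'n^'n"
  assumes nrm: "is_norm nrm" and T: "\<And>x. T x = A *v x + v" "contracting_wrt nrm T"
  obtains p where "T p = p"
proof -
  obtain c where c: "c < 1" "\<And>x y. nrm (T x - T y) \<le> c * nrm (x - y)"
    using T(2) by (auto simp: contracting_wrt_def)
  let ?f = "\<lambda>x. x - A *v x"
  have lin: "linear ?f"
    by (rule linearI) (simp_all add: matrix_vector_right_distrib matrix_vector_mult_scaleR algebra_simps)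
  have "x = 0" if "?f x = 0" for x
  proof -
    \<comment> \<open>If \<open>A *v x = x\<close>, then \<open>T x - T 0 = x\<close>.\<close>
    have "nrm x \<le> c * nrm x"
      using c(2)[of x 0] that by (simp add: T(1))
    then have "(1 - c) * nrm x \<le> 0" by (simp add: algebra_simps)
    then have "nrm x \<le> 0" using c(1) by (simp add: mult_le_0_iff)
    then show ?thesis using nrm unfolding is_norm_def by (metis order_antisym)
  qed
  then have "inj ?f"
    using linear_injective_0[OF lin] by blast
  then have "surj ?f"
    by (rule linear_inj_imp_surj[OF lin])
  then obtain p where "v = p - A *v p" by (metis surjD)
  then have "T p = p" by (simp add: T(1))
  then show ?thesis by (rule that)
qed

theorem theorem2:
  fixes N D :: nat
    and nrm :: "real^'d \<Rightarrow> real"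
    and T :: "nat \<Rightarrow> real^'d \<Rightarrow> real^'d"
    and A :: "nat \<Rightarrow> real^'d^'d"
    and v :: "nat \<Rightarrow> real^'d"
  assumes "N \<ge> 1"
    and "\<And>i x. i \<in> {1..N} \<Longrightarrow> T i x = A i *v x + v i"
    and "is_norm nrm"
    and "\<And>i. i \<in> {1..N} \<Longrightarrow> contracting_wrt nrm (T i)"
    and "D = dim (matrix_subalgebra hull (insert (mat 1) (A ` {1..N})))"
  shows "(\<exists>X :: (real^'d) set.
            affine X \<and> X \<noteq> {} \<and> aff_dim X \<le> int ((N - 1) * D) \<and>
            (\<forall>i\<in>{1..N}. T i ` X \<subseteq> X) \<and>
            attractor N T \<subseteq> X) \<and>
         (ereal (real ((N - 1) * D)) < affinity_dim N A \<longrightarrow>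
            hausdorff_dim (attractor N T) < affinity_dim N A)"
proof -
  define S where "S = matrix_subalgebra hull (insert (mat 1) (A ` {1..N}))"
  have S: "matrix_subalgebra S" "mat 1 \<in> S" "\<And>i. i \<in> {1..N} \<Longrightarrow> A i \<in> S"
    unfolding S_def by (auto simp: matrix_subalgebra_hull intro: hull_inc)
  obtain p where p: "T 1 p = p"
    using contracting_affine_fixed_point[of nrm "T 1" "A 1" "v 1"] assms(1-4) by auto
  define w where "w = (\<lambda>i. T i p - p)"
  \<comment> \<open>The index starts at 2 because \<open>w 1 = 0\<close>; this is what gives the
    factor \<open>N - 1\<close> instead of \<open>N\<close>.\<close>
  define V where "V = span (\<Union>i\<in>{2..N}. (\<lambda>B. B *v w i) ` S)"
  have subV: "subspace V" by (simp add: V_def)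
  have dimV: "dim V \<le> (N - 1) * D"
    using dim_span_orbits_le[of "{2..N}" w S] unfolding V_def assms(5) S_def by simp
  have w: "w i \<in> V" if "i \<in> {1..N}" for i
  proof (cases "i = 1")
    case True
    then show ?thesis using p subV by (simp add: w_def subspace_0)
  next
    case False
    then have "w i = mat 1 *v w i" "i \<in> {2..N}" using that by auto
    then show ?thesis
      unfolding V_def using S(2) by (intro span_base) blast
  qed
  have AV: "A i *v u \<in> V" if "i \<in> {1..N}" "u \<in> V" for i u
    using that(2) unfolding V_def
  proof (induction rule: span_induct_alt)
    case base
    then show ?case by (simp add: span_0)
  next
    case (step a x y)
    then obtain j B where "j \<in> {2..N}" "B \<in> S" "x = B *v w j" by auto
    moreover have "A i ** B \<in> S"
      using S(1,3) that(1) \<open>B \<in> S\<close> by (simp add: matrix_subalgebra_def)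
    \<comment> \<open>Generators go to generators:
      \<open>A i *v (B *v w j) = (A i ** B) *v w j\<close>, and \<open>S\<close> is closed under
      products.\<close>
    ultimately have "A i *v x \<in> (\<Union>i\<in>{2..N}. (\<lambda>B. B *v w i) ` S)"
      by (auto simp: matrix_vector_mul_assoc)
    then show ?case
      using step by (simp add: matrix_vector_right_distrib matrix_vector_mult_scaleR
          span_add span_scale span_base)
  qed
  define X where "X = (+) p ` V"
  have affX: "affine X"
    unfolding X_def using affine_translation subspace_imp_affine[OF subV] by blast
  have neX: "X \<noteq> {}"
    unfolding X_def using subspace_0[OF subV] by blast
  have dimX: "aff_dim X \<le> int ((N - 1) * D)"
    unfolding X_def using dimV subV by (simp only: aff_dim_translation_eq aff_dim_subspace of_nat_le_iff)
  have invX: "T i ` X \<subseteq> X" if i: "i \<in> {1..N}" for i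
  proof
    fix y assume "y \<in> T i ` X"
    then obtain u where u: "u \<in> V" "y = T i (p + u)" by (auto simp: X_def)
    \<comment> \<open>\<open>T i (p + u) = T i p + A i *v u\<close>, and
      \<open>T i p = p + w i\<close>.\<close>
    have "y = p + (w i + A i *v u)"
      using i by (simp add: u(2) w_def assms(2) matrix_vector_right_distrib)
    moreover have "w i + A i *v u \<in> V"
      using w[OF i] AV[OF i u(1)] subspace_add[OF subV] by blast
    ultimately show "y \<in> X" by (auto simp: X_def)
  qed
  have att: "is_attractor N T (attractor N T)"
    by (rule is_attractor_attractor[OF assms(1,3,4)])
  obtain c where c: "0 \<le> c" "c < 1"
    "\<And>i x y. i \<in> {1..N} \<Longrightarrow> nrm (T i x - T i y) \<le> c * nrm (x - y)"
    using contracting_family_uniform[of nrm "{1..N}" T] assms by auto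
  \<comment> \<open>Affine subspaces of a finite-dimensional space are closed, so \<open>X\<close>
    qualifies as the forward invariant set.\<close>
  have attX: "attractor N T \<subseteq> X"
    by (rule subset_of_forward_invariant[where I = "{1..N}" and T = T, OF assms(3) c])
      (use is_attractorD[OF att] affX neX invX in \<open>simp_all add: affine_closed\<close>)
  have "hausdorff_dim (attractor N T) \<le> ereal (real (dim V))"
    using attX is_attractorD(2)[OF att] unfolding X_def
    by (intro hausdorff_dim_subset_affine[OF subV]) (simp_all add: compact_imp_bounded)
  also have "\<dots> \<le> ereal (real ((N - 1) * D))"
    using dimV by (simp only: ereal_less_eq of_nat_le_iff)
  finally have "hausdorff_dim (attractor N T) \<le> ereal (real ((N - 1) * D))" .
  then have "hausdorff_dim (attractor N T) < affinity_dim N A"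
    if "ereal (real ((N - 1) * D)) < affinity_dim N A"
    using that by (rule le_less_trans)
  then show ?thesis
    using affX neX dimX invX attX by blast
qed

end
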